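(* Let $d\in\mathbb{N}$, let $X,Y\subset\mathbb{R}^d$ be Delone sets and let $f:X\to Y$ be a bijection. Then: (1) $f$ is bi-Lipschitz if and only if $f$ is Lipschitz and co-uniformly continuous. (2) The following three conditions are equivalent: (a) $f$ is Lipschitz and pointwise co-Lipschitz; (b) $f$ is Lipschitz and co-homogeneous; (c) $f$ is Lipschitz and there exists $y\in Y$ such that $f$ is co-Lipschitz at $y$. (3) If $f$ is bi-Lipschitz then $f$ is Lipschitz and pointwise co-Lipschitz; and if $f$ is Lipschitz and pointwise co-Lipschitz then $f$ is Lipschitz. (4) Neither of the converses of the two implications in (3) holds in general: for every $d\in\mathbb{N}$ there exist Delone sets $X,Y\subset\mathbb{R}^d$ and a bijection $f:X\to Y$ which is Lipschitz and pointwise co-Lipschitz but not bi-Lipschitz, and there exist Delone sets $X,Y\subset\mathbb{R}^d$ and a bijection $f:X\to Y$ which is Lipschitz but not pointwise co-Lipschitz.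
   Context: $\mathbb{N}=\{1,2,\dots\}$, $\|\cdot\|$ is the Euclidean norm, and $B(x,r)$ is the open ball of radius $r$ centred at $x$. A set $Y\subset\mathbb{R}^d$ is a Delone set if there is $s>0$ such that every closed ball of radius $s$ in $\mathbb{R}^d$ contains at most one point of $Y$, and there is $S>0$ such that every closed ball of radius $S$ in $\mathbb{R}^d$ contains at least one point of $Y$. Let $K,X\subseteq\mathbb{R}^d$ and let $f:K\to X$ be a map. - $f$ is Lipschitz at $y\in K$ if there is $L=L(y)>0$ with $\|f(x)-f(y)\|\le L\|x-y\|$ for every $x\in K$; $f$ is pointwise Lipschitz if it is Lipschitz at every $y\in K$. - If $f$ is a bijection, $f$ is co-Lipschitz at $y\in X$ if $f^{-1}$ is Lipschitz at $y$; $f$ is pointwise co-Lipschitz if $f^{-1}$ is pointwise Lipschitz; $f$ is bi-Lipschitz if $f$ and $f^{-1}$ are both Lipschitz. - A bijection $f$ is co-uniformly continuous if there is a strictly increasing function $\omega:(0,\infty)\to(0,\infty)$ such that $f^{-1}(B(f(x),r))\subseteq B(x,\omega(r))$ for every $x\in K$ and $r>0$. - $f$ is homogeneous if there are a non-decreasing function $\omega:[0,2)\to[0,\infty)$ with $\omega(0)=0$ and a constant $c>0$ such that for each $R>0$, $\|f(x)-f(y)\|\le cR\,\omega(\|x-y\|/R)$ whenever $x,y\in B(0,R)\cap K$. A bijection $f$ is co-homogeneous if $f^{-1}$ is homogeneous. *)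

theory Defs
  imports "HOL-Analysis.Analysis"
begin

text \<open>
  A map between subsets of \<open>\<real>\<^sup>d\<close> is a total function together with its domain \<open>K\<close>; nothing below
  depends on its values outside \<open>K\<close>. The notions that involve the inverse are meant for
  \<open>f\<close> with \<open>bij_betw f K X\<close>; the inverse is then \<open>inv_into K f\<close>, considered as a map on \<open>X\<close>.
\<close>

definition delone :: "'a::metric_space set \<Rightarrow> bool" where
  "delone Y \<longleftrightarrow>
     (\<exists>s>0. \<forall>x. \<forall>a \<in> Y \<inter> cball x s. \<forall>b \<in> Y \<inter> cball x s. a = b) \<and>
     (\<exists>S>0. \<forall>x. Y \<inter> cball x S \<noteq> {})"

definition lipschitz :: "'a::metric_space set \<Rightarrow> ('a \<Rightarrow> 'b::metric_space) \<Rightarrow> bool" where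
  "lipschitz K f \<longleftrightarrow> (\<exists>L. L-lipschitz_on K f)"

definition bi_lipschitz ::
  "'a::metric_space set \<Rightarrow> 'b::metric_space set \<Rightarrow> ('a \<Rightarrow> 'b) \<Rightarrow> bool" where
  "bi_lipschitz K X f \<longleftrightarrow> lipschitz K f \<and> lipschitz X (inv_into K f)"

definition lipschitz_at ::
  "'a::real_normed_vector set \<Rightarrow> ('a \<Rightarrow> 'b::real_normed_vector) \<Rightarrow> 'a \<Rightarrow> bool" where
  "lipschitz_at K f y \<longleftrightarrow> (\<exists>L>0. \<forall>x\<in>K. norm (f x - f y) \<le> L * norm (x - y))"

definition pointwise_lipschitz ::
  "'a::real_normed_vector set \<Rightarrow> ('a \<Rightarrow> 'b::real_normed_vector) \<Rightarrow> bool" where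
  "pointwise_lipschitz K f \<longleftrightarrow> (\<forall>y\<in>K. lipschitz_at K f y)"

definition co_lipschitz_at ::
  "'a::real_normed_vector set \<Rightarrow> 'b::real_normed_vector set \<Rightarrow> ('a \<Rightarrow> 'b) \<Rightarrow> 'b \<Rightarrow> bool" where
  "co_lipschitz_at K X f y \<longleftrightarrow> lipschitz_at X (inv_into K f) y"

definition pointwise_co_lipschitz ::
  "'a::real_normed_vector set \<Rightarrow> 'b::real_normed_vector set \<Rightarrow> ('a \<Rightarrow> 'b) \<Rightarrow> bool" where
  "pointwise_co_lipschitz K X f \<longleftrightarrow> pointwise_lipschitz X (inv_into K f)"

definition co_uniformly_continuous ::
  "'a::metric_space set \<Rightarrow> ('a \<Rightarrow> 'b::metric_space) \<Rightarrow> bool" where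
  "co_uniformly_continuous K f \<longleftrightarrow>
     (\<exists>\<omega> :: real \<Rightarrow> real. \<omega> \<in> {0<..} \<rightarrow> {0<..} \<and> strict_mono_on {0<..} \<omega> \<and>
        (\<forall>x\<in>K. \<forall>r>0. f -` ball (f x) r \<inter> K \<subseteq> ball x (\<omega> r)))"

text \<open>The modulus \<open>\<omega>\<close> is not required to be continuous at \<open>0\<close>. For \<open>x\<close>, \<open>y\<close> in \<open>ball 0 R\<close> the
  argument \<open>norm (x - y) / R\<close> always lies in the domain \<open>{0..<2}\<close> of \<open>\<omega>\<close>.\<close>

definition homogeneous ::
  "'a::real_normed_vector set \<Rightarrow> ('a \<Rightarrow> 'b::real_normed_vector) \<Rightarrow> bool" where
  "homogeneous K f \<longleftrightarrow>
     (\<exists>(\<omega> :: real \<Rightarrow> real) c. \<omega> \<in> {0..<2} \<rightarrow> {0..} \<and> mono_on {0..<2} \<omega> \<and> \<omega> 0 = 0 \<and> c > 0 \<and>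
        (\<forall>R>0. \<forall>x \<in> ball 0 R \<inter> K. \<forall>y \<in> ball 0 R \<inter> K.
           norm (f x - f y) \<le> c * R * \<omega> (norm (x - y) / R)))"

definition co_homogeneous ::
  "'a::real_normed_vector set \<Rightarrow> 'b::real_normed_vector set \<Rightarrow> ('a \<Rightarrow> 'b) \<Rightarrow> bool" where
  "co_homogeneous K X f \<longleftrightarrow> homogeneous X (inv_into K f)"

end

theory Submission
  imports Defs
begin

text \<open>
  For Delone sets, distinct points have distance bounded below, so additive errors are absorbed by
  the Lipschitz constant. In (1), two points of \<open>Y\<close> are joined by a chain of points of \<open>Y\<close> with
  bounded gaps that follows the segment between them. In (2), the triangle inequality
  through a single base point suffices; since the modulus of homogeneity may jump at \<open>0\<close>, the
  step function \<open>t \<mapsto> [t \<noteq> 0]\<close> can be taken.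

  For (4), \<open>\<int>\<close> is cut into blocks \<open>[3a\<^sub>j, 3a\<^sub>j\<^sub>+\<^sub>1)\<close>. On each block the map goes up through the
  residue class \<open>0\<close> modulo \<open>3\<close>, down through the class \<open>1\<close> and up again through the class \<open>2\<close>. This
  is a \<open>3\<close>-Lipschitz permutation of \<open>\<int>\<close> whose inverse separates the neighbours \<open>3a\<^sub>j\<close> and
  \<open>3a\<^sub>j + 2\<close> by two thirds of the block length. Blocks of length comparable to \<open>a\<^sub>j\<close> give the first
  example, blocks of length much larger than \<open>a\<^sub>j\<close> the second. In dimension \<open>d\<close> this map
  acts on one coordinate of \<open>\<int>\<^sup>d\<close>.
\<close>

section \<open>Delone sets and moduli of continuity\<close>

lemma delone_separated:
  assumes "delone Y"
  obtains s where "s > 0" "\<And>a b. a \<in> Y \<Longrightarrow> b \<in> Y \<Longrightarrow> a \<noteq> b \<Longrightarrow> s < dist a b"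
proof -
  obtain s where s: "s > 0" "\<forall>x. \<forall>a\<in>Y \<inter> cball x s. \<forall>b\<in>Y \<inter> cball x s. a = b"
    using assms unfolding delone_def by (elim conjE exE)
  have "s < dist a b" if "a \<in> Y" "b \<in> Y" "a \<noteq> b" for a b
    using s(1) spec[OF s(2), of a] that by force
  then show thesis using s(1) that by blast
qed

lemma delone_relatively_dense:
  assumes "delone Y"
  obtains S where "S > 0" "\<And>x. \<exists>p\<in>Y. dist x p \<le> S"
proof -
  obtain S where S: "S > 0" "\<forall>x. Y \<inter> cball x S \<noteq> {}"
    using assms unfolding delone_def by (elim conjE exE)
  have "\<exists>p\<in>Y. dist x p \<le> S" for x
    using spec[OF S(2), of x] by auto
  then show thesis using S(1) that by blast
qed

text \<open>Walking along the segment in unit steps and rounding each stop to a point of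
  \<open>Y\<close> gives links of length at most \<open>2 * S + 1\<close>, each costing at most a
  constant. The number of links is linear in the distance plus an additive constant.\<close>

lemma lipschitz_if_bounded_at_scale:
  fixes Y :: "'a::real_normed_vector set" and g :: "'a \<Rightarrow> 'b::metric_space"
  assumes "delone Y"
    and bounded: "\<And>r. \<exists>C. \<forall>y\<in>Y. \<forall>z\<in>Y. dist y z \<le> r \<longrightarrow> dist (g y) (g z) \<le> C"
  shows "lipschitz Y g"
proof -
  obtain s where s: "s > 0" "\<And>a b. a \<in> Y \<Longrightarrow> b \<in> Y \<Longrightarrow> a \<noteq> b \<Longrightarrow> s < dist a b"
    using delone_separated[OF assms(1)] by blast
  obtain S where S: "S > 0" "\<And>x. \<exists>p\<in>Y. dist x p \<le> S"
    using delone_relatively_dense[OF assms(1)] by blast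
  obtain C0 where C0: "\<forall>y\<in>Y. \<forall>z\<in>Y. dist y z \<le> 2 * S + 1 \<longrightarrow> dist (g y) (g z) \<le> C0"
    using bounded by blast
  define C where "C = max C0 0"
  have C: "C \<ge> 0" "\<And>y z. y \<in> Y \<Longrightarrow> z \<in> Y \<Longrightarrow> dist y z \<le> 2 * S + 1 \<Longrightarrow> dist (g y) (g z) \<le> C"
    using C0 unfolding C_def by (simp, meson max.coboundedI1)
  \<comment> \<open>The stops \<open>w\<close> lie on the segment and need not belong to
    \<open>Y\<close>; only their roundings \<open>p\<close> do. Hence the induction is over
    both.\<close>
  have chain: "dist (g y) (g p) \<le> C * (real n + 1)"
    if "y \<in> Y" "p \<in> Y" "dist y w \<le> real n" "dist w p \<le> S" for y p w n
    using that
  proof (induction n arbitrary: w p)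
    case 0
    then show ?case using C(2)[of y p] S(1) by simp
  next
    case (Suc n)
    \<comment> \<open>Shrinking \<open>w\<close> towards \<open>y\<close> by this factor leaves
      \<open>w'\<close> within \<open>n\<close> of \<open>y\<close> and within \<open>1\<close> of
      \<open>w\<close>.\<close>
    define w' where "w' = y + (real n / (real n + 1)) *\<^sub>R (w - y)"
    have "dist y w' = (real n / (real n + 1)) * dist y w"
      by (simp add: w'_def dist_norm norm_minus_commute)
    also have "\<dots> \<le> (real n / (real n + 1)) * (real n + 1)"
      using Suc.prems(3) by (intro mult_left_mono) auto
    also have "\<dots> = real n" by simp
    finally have yw': "dist y w' \<le> real n" .
    have "w - w' = (1 - real n / (real n + 1)) *\<^sub>R (w - y)"
      by (simp add: w'_def scaleR_left_diff_distrib)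
    also have "1 - real n / (real n + 1) = 1 / (real n + 1)"
      by (simp add: field_simps)
    finally have "norm (w - w') = dist y w / (real n + 1)"
      by (simp add: dist_norm norm_minus_commute)
    moreover have "dist y w / (real n + 1) \<le> 1"
      using Suc.prems(3) by (simp add: field_simps)
    ultimately have w'w: "dist w' w \<le> 1"
      by (simp add: dist_norm norm_minus_commute)
    obtain q where q: "q \<in> Y" "dist w' q \<le> S" using S(2) by blast
    have "dist q p \<le> 2 * S + 1"
      using dist_triangle[of q p w'] dist_triangle[of w' p w] w'w q(2) Suc.prems(4)
      by (simp add: dist_commute)
    then have "dist (g q) (g p) \<le> C" using C(2) q(1) Suc.prems(2) by blast
    moreover have "dist (g y) (g q) \<le> C * (real n + 1)"
      using Suc.IH[of q w'] Suc.prems(1) q yw' by blast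
    ultimately show ?case
      using dist_triangle[of "g y" "g p" "g q"] by (simp add: algebra_simps)
  qed
  have "dist (g y) (g z) \<le> C * (1 + 2 / s) * dist y z" if "y \<in> Y" "z \<in> Y" for y z
  proof (cases "y = z")
    case False
    define n where "n = nat \<lceil>dist y z\<rceil>"
    have "dist y z \<le> real n" "real n \<le> dist y z + 1"
      unfolding n_def using ceiling_correct[of "dist y z"] zero_le_dist[of y z] by linarith+
    then have "dist (g y) (g z) \<le> C * (real n + 1)"
      using chain[of y z z n] that S(1) by simp
    also have "\<dots> \<le> C * (dist y z + 2)"
      using C(1) \<open>real n \<le> dist y z + 1\<close> by (intro mult_left_mono) auto
    \<comment> \<open>Separation absorbs the additive \<open>2\<close>, because
      \<open>s < dist y z\<close>.\<close>
    also have "\<dots> \<le> C * ((1 + 2 / s) * dist y z)"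
      using C(1) s(1) s(2)[OF that False] by (intro mult_left_mono) (auto simp: field_simps)
    finally show ?thesis by (simp add: mult.assoc)
  qed simp
  then have "(C * (1 + 2 / s))-lipschitz_on Y g"
    using C(1) s(1) by (intro lipschitz_onI) auto
  then show ?thesis unfolding lipschitz_def by blast
qed

section \<open>Lipschitz at one point, Lipschitz at every point, and homogeneity\<close>

lemma lipschitz_imp_pointwise_lipschitz:
  assumes "lipschitz K f"
  shows "pointwise_lipschitz K f"
proof -
  obtain L where L: "L-lipschitz_on K f" using assms unfolding lipschitz_def by blast
  \<comment> \<open>\<open>lipschitz_at\<close> demands a positive constant, whereas
    \<open>L\<close> may be \<open>0\<close>.\<close>
  have "(L + 1)-lipschitz_on K f"
    using lipschitz_on_le[OF L] by simp
  then show ?thesis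
    using lipschitz_on_nonneg[OF L] lipschitz_onD unfolding pointwise_lipschitz_def lipschitz_at_def
    by (metis add_nonneg_pos dist_norm zero_less_one)
qed

text \<open>Passing through the old base point \<open>y\<close> costs an additive multiple of
  \<open>norm (y - z)\<close>. As \<open>x\<close> and \<open>z\<close> are more than
  \<open>s\<close> apart, this is at most a multiple of \<open>norm (x - z)\<close>.\<close>

lemma pointwise_lipschitz_if_lipschitz_at:
  assumes "delone Y" "y \<in> Y" "lipschitz_at Y g y"
  shows "pointwise_lipschitz Y g"
  unfolding pointwise_lipschitz_def
proof
  fix z assume z: "z \<in> Y"
  obtain s where s: "s > 0" "\<And>a b. a \<in> Y \<Longrightarrow> b \<in> Y \<Longrightarrow> a \<noteq> b \<Longrightarrow> s < dist a b"
    using delone_separated[OF assms(1)] by blast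
  obtain L where L: "L > 0" "\<And>x. x \<in> Y \<Longrightarrow> norm (g x - g y) \<le> L * norm (x - y)"
    using assms(3) unfolding lipschitz_at_def by blast
  define L' where "L' = L * (1 + 2 * norm (y - z) / s)"
  have "norm (g x - g z) \<le> L' * norm (x - z)" if x: "x \<in> Y" for x
  proof (cases "x = z")
    case False
    have "norm (g x - g z) \<le> norm (g x - g y) + norm (g z - g y)"
      using norm_triangle_ineq4[of "g x - g y" "g z - g y"] by simp
    also have "\<dots> \<le> L * (norm (x - y) + norm (z - y))"
      using L(2)[OF x] L(2)[OF z] by (simp add: algebra_simps)
    also have "\<dots> \<le> L * (norm (x - z) + 2 * norm (y - z))"
      using L(1) norm_triangle_ineq4[of "x - z" "y - z"]
      by (intro mult_left_mono) (auto simp: norm_minus_commute)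
    also have "\<dots> \<le> L * (norm (x - z) + 2 * norm (y - z) / s * norm (x - z))"
    proof -
      have "2 * norm (y - z) / s * s \<le> 2 * norm (y - z) / s * norm (x - z)"
        using s(1) s(2)[OF x z False] by (intro mult_left_mono) (auto simp: dist_norm)
      then show ?thesis using s(1) L(1) by (intro mult_left_mono) auto
    qed
    finally show ?thesis by (simp add: L'_def algebra_simps)
  qed simp
  moreover have "L' > 0" using L(1) s(1) by (auto simp: L'_def intro!: mult_pos_pos add_pos_nonneg)
  ultimately show "lipschitz_at Y g z" unfolding lipschitz_at_def by blast
qed

text \<open>For a radius \<open>R\<close> comparable to \<open>norm (x - y)\<close> the argument of
  the modulus is at most \<open>1\<close>, so monotonicity leaves the bound
  \<open>c * R * \<omega> 1\<close>, linear in \<open>R\<close>.\<close>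

lemma homogeneous_imp_lipschitz_at:
  assumes "delone Y" "y \<in> Y" "homogeneous Y g"
  shows "lipschitz_at Y g y"
proof -
  obtain s where s: "s > 0" "\<And>a b. a \<in> Y \<Longrightarrow> b \<in> Y \<Longrightarrow> a \<noteq> b \<Longrightarrow> s < dist a b"
    using delone_separated[OF assms(1)] by blast
  obtain \<omega> :: "real \<Rightarrow> real" and c
    where \<omega>: "\<omega> \<in> {0..<2} \<rightarrow> {0..}" "mono_on {0..<2} \<omega>" "c > 0"
      and hom: "\<And>R a b. R > 0 \<Longrightarrow> a \<in> ball 0 R \<inter> Y \<Longrightarrow> b \<in> ball 0 R \<inter> Y \<Longrightarrow>
            norm (g a - g b) \<le> c * R * \<omega> (norm (a - b) / R)"
    using assms(3) unfolding homogeneous_def by blast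
  have \<omega>1: "\<omega> 1 \<ge> 0" using \<omega>(1) by auto
  \<comment> \<open>The final \<open>1\<close> keeps \<open>L\<close> positive when
    \<open>\<omega> 1 = 0\<close>.\<close>
  define L where "L = c * \<omega> 1 * (1 + (norm y + 1) / s) + 1"
  have "norm (g x - g y) \<le> L * norm (x - y)" if x: "x \<in> Y" for x
  proof (cases "x = y")
    case False
    \<comment> \<open>The summand \<open>1\<close> puts \<open>x\<close> and \<open>y\<close>
      strictly inside the open ball; separation later absorbs \<open>norm y + 1\<close>.\<close>
    define R where "R = norm (x - y) + norm y + 1"
    have R: "R > 0" "norm (x - y) \<le> R" by (auto simp: R_def add_nonneg_pos)
    have "norm x < R" "norm y < R"
      using norm_triangle_ineq[of "x - y" y] norm_ge_zero[of "x - y"] unfolding R_def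
      by (simp, linarith)
    then have "norm (g x - g y) \<le> c * R * \<omega> (norm (x - y) / R)"
      using hom[OF R(1), of x y] x assms(2) by simp
    also have "\<dots> \<le> c * R * \<omega> 1"
    proof (rule mult_left_mono)
      show "\<omega> (norm (x - y) / R) \<le> \<omega> 1"
        using R by (intro mono_onD[OF \<omega>(2)]) (auto simp: field_simps)
    qed (use \<omega> R in auto)
    also have "\<dots> = c * \<omega> 1 * R" by simp
    also have "\<dots> \<le> c * \<omega> 1 * ((1 + (norm y + 1) / s) * norm (x - y))"
    proof (rule mult_left_mono)
      have "(norm y + 1) / s * s \<le> (norm y + 1) / s * norm (x - y)"
        using s(1) s(2)[OF x assms(2) False] by (intro mult_left_mono) (auto simp: dist_norm)
      moreover have "(norm y + 1) / s * s = norm y + 1" using s(1) by simp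
      ultimately show "R \<le> (1 + (norm y + 1) / s) * norm (x - y)"
        unfolding R_def distrib_right by linarith
    qed (use \<omega> \<omega>1 in auto)
    also have "\<dots> \<le> L * norm (x - y)" by (simp add: L_def algebra_simps)
    finally show ?thesis .
  qed simp
  moreover have "L > 0"
    using \<omega>(3) \<omega>1 s(1) by (auto simp: L_def intro!: add_nonneg_pos mult_nonneg_nonneg)
  ultimately show ?thesis unfolding lipschitz_at_def by blast
qed

lemma lipschitz_at_imp_homogeneous:
  assumes "delone Y" "lipschitz_at Y g y"
  shows "homogeneous Y g"
proof -
  obtain s where s: "s > 0" "\<And>a b. a \<in> Y \<Longrightarrow> b \<in> Y \<Longrightarrow> a \<noteq> b \<Longrightarrow> s < dist a b"
    using delone_separated[OF assms(1)] by blast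
  obtain L where L: "L > 0" "\<And>x. x \<in> Y \<Longrightarrow> norm (g x - g y) \<le> L * norm (x - y)"
    using assms(2) unfolding lipschitz_at_def by blast
  define \<omega> :: "real \<Rightarrow> real" where "\<omega> t = (if t = 0 then 0 else 1)" for t
  define c where "c = 2 * L * (1 + 2 * norm y / s)"
  have "norm (g a - g b) \<le> c * R * \<omega> (norm (a - b) / R)"
    if R: "R > 0" and a: "a \<in> ball 0 R \<inter> Y" and b: "b \<in> ball 0 R \<inter> Y" for R a b
  proof (cases "a = b")
    case False
    \<comment> \<open>Two distinct points of \<open>Y\<close> in the ball bound \<open>R\<close>
      from below, so \<open>norm y\<close> is at most a fixed multiple of \<open>R\<close>.\<close>
    have "s < 2 * R"
      using s(2)[of a b] a b False norm_triangle_ineq4[of a b] by (auto simp: dist_norm)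
    have "norm (g a - g b) \<le> norm (g a - g y) + norm (g b - g y)"
      using norm_triangle_ineq4[of "g a - g y" "g b - g y"] by simp
    also have "\<dots> \<le> L * (norm (a - y) + norm (b - y))"
      using L(2)[of a] L(2)[of b] a b by (simp add: algebra_simps)
    also have "\<dots> \<le> L * (2 * R + 2 * norm y)"
      using L(1) a b norm_triangle_ineq4[of a y] norm_triangle_ineq4[of b y]
      by (intro mult_left_mono) auto
    also have "\<dots> \<le> L * (2 * R + 2 * (2 * norm y / s * R))"
    proof -
      have "norm y / s * s \<le> norm y / s * (2 * R)"
        using s(1) \<open>s < 2 * R\<close> by (intro mult_left_mono) auto
      then show ?thesis using s(1) L(1) by (intro mult_left_mono) auto
    qed
    also have "\<dots> = c * R" by (simp add: c_def algebra_simps)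
    finally show ?thesis using R False by (simp add: \<omega>_def)
  qed (simp add: \<omega>_def)
  moreover have "c > 0" using L(1) s(1) by (auto simp: c_def intro!: mult_pos_pos add_pos_nonneg)
  moreover have "\<omega> \<in> {0..<2} \<rightarrow> {0..}" "mono_on {0..<2} \<omega>" "\<omega> 0 = 0"
    by (auto simp: \<omega>_def intro!: mono_onI)
  ultimately show ?thesis unfolding homogeneous_def by blast
qed

section \<open>Inverses of bijections\<close>

text \<open>Substituting \<open>f x\<close> for the points of \<open>Y\<close> eliminates
  \<open>inv_into\<close>.\<close>

lemma lipschitz_inv_into_iff:
  assumes "bij_betw f X Y"
  shows "lipschitz Y (inv_into X f) \<longleftrightarrow>
    (\<exists>L\<ge>0. \<forall>x\<in>X. \<forall>z\<in>X. dist x z \<le> L * dist (f x) (f z))"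
proof -
  have "Y = f ` X" "inj_on f X" using assms by (auto simp: bij_betw_def)
  then show ?thesis unfolding lipschitz_def lipschitz_on_def by auto
qed

lemma lipschitz_at_inv_into_iff:
  assumes "bij_betw f X Y" "x \<in> X"
  shows "lipschitz_at Y (inv_into X f) (f x) \<longleftrightarrow>
    (\<exists>L>0. \<forall>z\<in>X. norm (z - x) \<le> L * norm (f z - f x))"
proof -
  have "Y = f ` X" "inj_on f X" using assms by (auto simp: bij_betw_def)
  then show ?thesis using assms(2) unfolding lipschitz_at_def by auto
qed

lemma bi_lipschitz_imp_co_uniformly_continuous:
  assumes "bij_betw f X Y" "bi_lipschitz X Y f"
  shows "co_uniformly_continuous X f"
proof -
  obtain L where L: "L \<ge> 0" "\<And>x z. x \<in> X \<Longrightarrow> z \<in> X \<Longrightarrow> dist x z \<le> L * dist (f x) (f z)"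
    using assms lipschitz_inv_into_iff[OF assms(1)] unfolding bi_lipschitz_def by blast
  \<comment> \<open>With \<open>L + 1\<close> the modulus is strictly increasing even for
    \<open>L = 0\<close>, and the estimate is strict, as the open ball requires.\<close>
  define \<omega> where "\<omega> r = (L + 1) * r" for r :: real
  have "f -` ball (f x) r \<inter> X \<subseteq> ball x (\<omega> r)" if "x \<in> X" "r > 0" for x r
  proof
    fix z assume z: "z \<in> f -` ball (f x) r \<inter> X"
    have "dist x z \<le> L * dist (f x) (f z)" using L(2) that z by blast
    also have "\<dots> \<le> L * r" using L(1) z by (intro mult_left_mono) auto
    also have "\<dots> < \<omega> r" using that by (simp add: \<omega>_def algebra_simps)
    finally show "z \<in> ball x (\<omega> r)" by simp
  qed
  moreover have "\<omega> \<in> {0<..} \<rightarrow> {0<..}" "strict_mono_on {0<..} \<omega>"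
    using L(1) by (auto simp: \<omega>_def strict_mono_on_def)
  ultimately show ?thesis unfolding co_uniformly_continuous_def by blast
qed

lemma co_uniformly_continuous_imp_lipschitz_inv:
  fixes X :: "'a::metric_space set" and Y :: "'b::real_normed_vector set"
  assumes "delone Y" "bij_betw f X Y" "co_uniformly_continuous X f"
  shows "lipschitz Y (inv_into X f)"
proof (rule lipschitz_if_bounded_at_scale[OF assms(1)])
  fix r :: real
  obtain \<omega> :: "real \<Rightarrow> real" where
    \<omega>: "\<And>x r. x \<in> X \<Longrightarrow> r > 0 \<Longrightarrow> f -` ball (f x) r \<inter> X \<subseteq> ball x (\<omega> r)"
    using assms(3) unfolding co_uniformly_continuous_def by blast
  have Y: "Y = f ` X" "inj_on f X" using assms(2) by (auto simp: bij_betw_def)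
  \<comment> \<open>The radius \<open>\<bar>r\<bar> + 1\<close> is positive and strictly exceeds
    \<open>r\<close>, so the closed condition fits into the open ball.\<close>
  have "dist x z \<le> \<omega> (\<bar>r\<bar> + 1)" if "x \<in> X" "z \<in> X" "dist (f x) (f z) \<le> r" for x z
    using \<omega>[of x "\<bar>r\<bar> + 1"] that by force
  then show "\<exists>C. \<forall>y\<in>Y. \<forall>z\<in>Y. dist y z \<le> r \<longrightarrow> dist (inv_into X f y) (inv_into X f z) \<le> C"
    using Y by (intro exI[of _ "\<omega> (\<bar>r\<bar> + 1)"]) auto
qed

section \<open>A Lipschitz permutation of the integers\<close>

text \<open>For \<open>n > 0\<close> the turns, from \<open>3 * n - 3\<close> to
  \<open>3 * n - 2\<close> and from \<open>1\<close> to \<open>2\<close>, are unit steps. The end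
  points \<open>0\<close> and \<open>3 * n - 1\<close> are fixed, which lets consecutive blocks fit
  together.\<close>

definition zigzag :: "int \<Rightarrow> int \<Rightarrow> int" where
  "zigzag n t =
     (if t < n then 3 * t else if t < 2 * n then 3 * (2 * n - 1 - t) + 1 else 3 * (t - 2 * n) + 2)"

text \<open>The residue modulo \<open>3\<close> of a value reveals its pass, giving injectivity; a
  finite set then forces surjectivity.\<close>

lemma bij_betw_zigzag: "bij_betw (zigzag n) {0..<3 * n} {0..<3 * n}"
proof -
  have "inj_on (zigzag n) {0..<3 * n}"
    by (rule inj_onI) (auto simp: zigzag_def split: if_splits; presburger)
  moreover have "zigzag n ` {0..<3 * n} \<subseteq> {0..<3 * n}"
    by (auto simp: zigzag_def)
  ultimately show ?thesis
    by (simp add: bij_betw_def endo_inj_surj)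
qed

lemma zigzag_step: "0 \<le> t \<Longrightarrow> \<bar>zigzag n (t + 1) - zigzag n t\<bar> \<le> 3"
  by (auto simp: zigzag_def)

section \<open>Gluing zigzags over consecutive blocks of integers\<close>

lemma strict_mono_int_unbounded:
  fixes a :: "nat \<Rightarrow> int"
  assumes "strict_mono a"
  shows "a 0 + int j \<le> a j"
proof (induction j)
  case (Suc j)
  then show ?case using strict_monoD[OF assms, of j "Suc j"] by simp
qed simp

lemma strict_mono_int_block:
  fixes a :: "nat \<Rightarrow> int"
  assumes "strict_mono a" "3 * a 0 \<le> x"
  shows "\<exists>!j. 3 * a j \<le> x \<and> x < 3 * a (Suc j)"
proof (rule ex_ex1I)
  have "x < 3 * a (Suc (nat (x - a 0 * 3)))"
    using strict_mono_int_unbounded[OF assms(1), of "Suc (nat (x - a 0 * 3))"] assms(2) by simp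
  then have ex: "\<exists>j. x < 3 * a (Suc j)" by blast
  \<comment> \<open>Minimality puts the end of the previous block, which is the start of this one,
    at or below \<open>x\<close>.\<close>
  define j where "j = (LEAST j. x < 3 * a (Suc j))"
  have "x < 3 * a (Suc j)" unfolding j_def using ex by (rule LeastI_ex)
  moreover have "3 * a j \<le> x"
  proof (cases j)
    case 0
    then show ?thesis using assms(2) by simp
  next
    case (Suc i)
    then have "i < j" by simp
    then have "\<not> x < 3 * a (Suc i)" unfolding j_def by (rule not_less_Least)
    then show ?thesis using Suc by simp
  qed
  ultimately show "\<exists>j. 3 * a j \<le> x \<and> x < 3 * a (Suc j)" by blast
next
  fix i j
  assume i: "3 * a i \<le> x \<and> x < 3 * a (Suc i)" and j: "3 * a j \<le> x \<and> x < 3 * a (Suc j)"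
  have "a i < a (Suc j)" "a j < a (Suc i)" using i j by auto
  then show "i = j"
    using strict_mono_less[OF assms(1)] by (metis less_antisym less_Suc_eq not_less_eq)
qed

text \<open>The factor \<open>3\<close> in the end points makes the gap of \<open>a\<close> the
  length of one pass. The index under \<open>THE\<close> is unique for strictly increasing
  \<open>a\<close>.\<close>

definition blockwise_zigzag :: "(nat \<Rightarrow> int) \<Rightarrow> int \<Rightarrow> int" where
  "blockwise_zigzag a x =
     (if x < 3 * a 0 then x
      else let j = (THE j. 3 * a j \<le> x \<and> x < 3 * a (Suc j))
           in 3 * a j + zigzag (a (Suc j) - a j) (x - 3 * a j))"

context
  fixes a :: "nat \<Rightarrow> int"
  assumes mono: "strict_mono a"
begin

lemma blockwise_zigzag_below: "x < 3 * a 0 \<Longrightarrow> blockwise_zigzag a x = x"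
  by (simp add: blockwise_zigzag_def)

lemma blockwise_zigzag_block:
  assumes "3 * a j \<le> x" "x < 3 * a (Suc j)"
  shows "blockwise_zigzag a x = 3 * a j + zigzag (a (Suc j) - a j) (x - 3 * a j)"
proof -
  have x: "3 * a 0 \<le> x"
    using assms(1) strict_mono_int_unbounded[OF mono, of j] by linarith
  have "(THE j. 3 * a j \<le> x \<and> x < 3 * a (Suc j)) = j"
    using strict_mono_int_block[OF mono x] assms by (intro the1_equality) auto
  then show ?thesis using x by (simp add: blockwise_zigzag_def)
qed

lemma block_cases:
  obtains "x < 3 * a 0" | j where "3 * a j \<le> x" "x < 3 * a (Suc j)"
  using strict_mono_int_block[OF mono, of x] by (meson not_less)

lemma blockwise_zigzag_bij_block:
  "bij_betw (blockwise_zigzag a) {3 * a j..<3 * a (Suc j)} {3 * a j..<3 * a (Suc j)}"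
proof -
  let ?n = "a (Suc j) - a j"
  have 1: "bij_betw (\<lambda>x. x - 3 * a j) {3 * a j..<3 * a (Suc j)} {0..<3 * ?n}"
    by (rule bij_betw_byWitness[where f' = "\<lambda>x. x + 3 * a j"]) auto
  have 2: "bij_betw (\<lambda>x. 3 * a j + x) {0..<3 * ?n} {3 * a j..<3 * a (Suc j)}"
    by (rule bij_betw_byWitness[where f' = "\<lambda>x. x - 3 * a j"]) auto
  have "bij_betw ((\<lambda>x. 3 * a j + x) \<circ> (zigzag ?n \<circ> (\<lambda>x. x - 3 * a j)))
      {3 * a j..<3 * a (Suc j)} {3 * a j..<3 * a (Suc j)}"
    using 1 bij_betw_zigzag 2 by (blast intro: bij_betw_trans)
  then show ?thesis
    by (rule bij_betw_cong[THEN iffD1, rotated]) (auto simp: blockwise_zigzag_block)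
qed

lemma blockwise_zigzag_mem_block:
  assumes "3 * a j \<le> x" "x < 3 * a (Suc j)"
  shows "3 * a j \<le> blockwise_zigzag a x" "blockwise_zigzag a x < 3 * a (Suc j)"
  using bij_betwE[OF blockwise_zigzag_bij_block[of j]] assms by auto

text \<open>The blocks and the half-line below them are disjoint and invariant, so a value in one
  piece comes only from that piece and bijectivity can be checked piecewise.\<close>

lemma bij_blockwise_zigzag: "bij (blockwise_zigzag a)"
proof (rule bijI)
  let ?h = "blockwise_zigzag a"
  have pre: "x \<in> {3 * a j..<3 * a (Suc j)}" if "?h x \<in> {3 * a j..<3 * a (Suc j)}" for x j
  proof (cases rule: block_cases[of x])
    case 1
    then show ?thesis
      using that blockwise_zigzag_below[of x] strict_mono_int_unbounded[OF mono, of j] by simp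
  next
    case (2 i)
    then have i: "3 * a i \<le> ?h x \<and> ?h x < 3 * a (Suc i)"
      using blockwise_zigzag_mem_block by simp
    then have "3 * a 0 \<le> ?h x" using strict_mono_int_unbounded[OF mono, of i] by linarith
    then have "i = j" using strict_mono_int_block[OF mono] i that by (metis atLeastLessThan_iff)
    then show ?thesis using 2 by simp
  qed
  show "inj ?h"
  proof (rule injI)
    fix x y assume eq: "?h x = ?h y"
    show "x = y"
    proof (cases rule: block_cases[of "?h x"])
      case 1
      have "z < 3 * a 0" if "?h z < 3 * a 0" for z
      proof (cases rule: block_cases[of z])
        case (2 i)
        then show ?thesis
          using that blockwise_zigzag_mem_block[of i z] strict_mono_int_unbounded[OF mono, of i]
          by linarith
      qed
      then show ?thesis using 1 eq blockwise_zigzag_below by metis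
    next
      case (2 j)
      then have "x \<in> {3 * a j..<3 * a (Suc j)}" "y \<in> {3 * a j..<3 * a (Suc j)}"
        using pre[of x j] pre[of y j] eq by auto
      then show ?thesis
        using bij_betw_imp_inj_on[OF blockwise_zigzag_bij_block] eq by (meson inj_onD)
    qed
  qed
  show "surj ?h"
    unfolding surj_def
  proof
    fix y
    show "\<exists>x. y = ?h x"
    proof (cases rule: block_cases[of y])
      case 1
      then show ?thesis using blockwise_zigzag_below by metis
    next
      case (2 j)
      then have "y \<in> ?h ` {3 * a j..<3 * a (Suc j)}"
        using bij_betw_imp_surj_on[OF blockwise_zigzag_bij_block] by simp
      then show ?thesis by blast
    qed
  qed
qed

lemma blockwise_zigzag_start: "blockwise_zigzag a (3 * a j) = 3 * a j"
  using blockwise_zigzag_block[of j "3 * a j"] strict_monoD[OF mono, of j "Suc j"]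
  by (simp add: zigzag_def)

text \<open>Together with \<open>blockwise_zigzag_start\<close> this exhibits two points at distance
  twice the gap of \<open>a\<close> whose images are at distance \<open>2\<close>.\<close>

lemma blockwise_zigzag_third_pass:
  "blockwise_zigzag a (3 * a j + 2 * (a (Suc j) - a j)) = 3 * a j + 2"
  using blockwise_zigzag_block[of j "3 * a j + 2 * (a (Suc j) - a j)"]
    strict_monoD[OF mono, of j "Suc j"]
  by (simp add: zigzag_def)

lemma blockwise_zigzag_step: "\<bar>blockwise_zigzag a (x + 1) - blockwise_zigzag a x\<bar> \<le> 3"
proof (cases rule: block_cases[of x])
  case 1
  show ?thesis
  proof (cases "x + 1 < 3 * a 0")
    case False
    then have "x + 1 = 3 * a 0" using 1 by linarith
    then show ?thesis using 1 blockwise_zigzag_start[of 0] blockwise_zigzag_below by simp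
  qed (use 1 blockwise_zigzag_below in simp)
next
  case (2 j)
  let ?n = "a (Suc j) - a j"
  show ?thesis
  proof (cases "x + 1 < 3 * a (Suc j)")
    case True
    then show ?thesis
      using 2 blockwise_zigzag_block[of j x] blockwise_zigzag_block[of j "x + 1"]
        zigzag_step[of "x - 3 * a j" ?n] by (simp add: algebra_simps)
  next
    case False
    then have x: "x + 1 = 3 * a (Suc j)" using 2 by linarith
    have "?n > 0" using strict_monoD[OF mono, of j "Suc j"] by simp
    moreover have "x - 3 * a j = 3 * ?n - 1" using x by (simp add: algebra_simps)
    \<comment> \<open>The last point of a block is fixed, as is the first point of the next, so the
      junction is a unit step.\<close>
    ultimately have "blockwise_zigzag a x = x"
      using blockwise_zigzag_block[OF 2] by (auto simp: zigzag_def)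
    then show ?thesis using x blockwise_zigzag_start[of "Suc j"] by simp
  qed
qed

lemma blockwise_zigzag_lipschitz:
  "\<bar>blockwise_zigzag a x - blockwise_zigzag a y\<bar> \<le> 3 * \<bar>x - y\<bar>"
proof -
  have *: "\<bar>blockwise_zigzag a (z + int k) - blockwise_zigzag a z\<bar> \<le> 3 * int k" for z k
  proof (induction k)
    case (Suc k)
    then show ?case using blockwise_zigzag_step[of "z + int k"] by (simp add: algebra_simps)
  qed simp
  show ?thesis
    using *[of y "nat (x - y)"] *[of x "nat (y - x)"] by (cases "y \<le> x") auto
qed

end

section \<open>Acting on one coordinate of the integer lattice\<close>

definition int_lattice :: "(real ^ 'n) set" where
  "int_lattice = {x. \<forall>i. x $ i \<in> \<int>}"

text \<open>On \<open>int_lattice\<close> the floor only converts an integral real to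
  \<open>int\<close>.\<close>

definition coord_map :: "'n \<Rightarrow> (int \<Rightarrow> int) \<Rightarrow> real ^ 'n \<Rightarrow> real ^ 'n" where
  "coord_map k h x = (\<chi> i. if i = k then of_int (h \<lfloor>x $ i\<rfloor>) else x $ i)"

text \<open>Points in a common ball of radius \<open>1/3\<close> have integer coordinates differing
  by less than \<open>1\<close>. Rounding down changes each coordinate by at most \<open>1\<close>,
  so the sum norm yields the covering radius.\<close>

lemma delone_int_lattice: "delone (int_lattice :: (real ^ 'n::finite) set)"
proof -
  have "u = v" if "u \<in> int_lattice \<inter> cball x (1/3)" "v \<in> int_lattice \<inter> cball x (1/3)"
    for x u v :: "real ^ 'n"
  proof -
    have "dist u v \<le> 2/3" using that dist_triangle2[of u v x] by (simp add: dist_commute)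
    then have "\<bar>u $ i - v $ i\<bar> < 1" for i
      using component_le_norm_cart[of "u - v" i] by (simp add: dist_norm)
    moreover have "u $ i \<in> \<int>" "v $ i \<in> \<int>" for i using that by (auto simp: int_lattice_def)
    ultimately show ?thesis
      using Ints_eq_abs_less1 by (metis vec_eq_iff)
  qed
  moreover have "int_lattice \<inter> cball x (real CARD('n)) \<noteq> {}" for x :: "real ^ 'n"
  proof -
    define p :: "real ^ 'n" where "p = (\<chi> i. of_int \<lfloor>x $ i\<rfloor>)"
    have "norm (x - p) \<le> (\<Sum>i\<in>UNIV. \<bar>(x - p) $ i\<bar>)" by (rule norm_le_l1_cart)
    also have "\<dots> \<le> (\<Sum>i\<in>(UNIV::'n set). 1)"
    proof (rule sum_mono)
      fix i show "\<bar>(x - p) $ i\<bar> \<le> 1"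
        unfolding p_def vector_minus_component vec_lambda_beta by linarith
    qed
    finally have "p \<in> cball x (real CARD('n))" by (simp add: dist_norm)
    moreover have "p \<in> int_lattice" by (simp add: p_def int_lattice_def)
    ultimately show ?thesis by blast
  qed
  moreover have "real CARD('n) > 0" by simp
  ultimately show ?thesis unfolding delone_def
    by (intro conjI exI[of _ "1/3"] exI[of _ "real CARD('n)"]) auto
qed

lemma bij_betw_coord_map:
  assumes "bij h"
  shows "bij_betw (coord_map k h) int_lattice int_lattice"
proof (rule bij_betw_byWitness[where f' = "coord_map k (inv h)"])
  have "coord_map k g x \<in> int_lattice" if "x \<in> int_lattice" for g and x :: "real ^ 'a"
    using that by (simp add: coord_map_def int_lattice_def)
  then show "coord_map k h ` int_lattice \<subseteq> int_lattice"
    "coord_map k (inv h) ` int_lattice \<subseteq> int_lattice" by auto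
qed (use assms in \<open>auto simp: coord_map_def int_lattice_def vec_eq_iff bij_is_inj
       bij_is_surj surj_f_inv_f elim!: Ints_cases\<close>)

text \<open>The estimate holds in each coordinate: by the bound on \<open>h\<close> in coordinate
  \<open>k\<close>, by \<open>L \<ge> 1\<close> in the others.\<close>

lemma coord_map_lipschitz:
  fixes x y :: "real ^ 'n::finite" and L :: int
  assumes "x \<in> int_lattice" "y \<in> int_lattice" "L \<ge> 1"
    and "\<And>m n. \<bar>h m - h n\<bar> \<le> L * \<bar>m - n\<bar>"
  shows "norm (coord_map k h x - coord_map k h y) \<le> of_int L * norm (x - y)"
proof -
  have "norm (coord_map k h x - coord_map k h y) \<le> norm (of_int L *\<^sub>R (x - y))"
  proof (rule norm_le_componentwise_cart)
    fix i
    obtain m n where mn: "x $ i = of_int m" "y $ i = of_int n"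
      using assms(1,2) unfolding int_lattice_def by (blast elim: Ints_cases)
    have *: "\<bar>real_of_int (h m) - of_int (h n)\<bar> \<le> of_int L * \<bar>of_int m - of_int n\<bar>"
      using assms(4)[of m n] by (metis of_int_abs of_int_diff of_int_le_iff of_int_mult)
    have "\<bar>real_of_int m - of_int n\<bar> \<le> of_int L * \<bar>of_int m - of_int n\<bar>"
      using assms(3) by (simp add: mult_le_cancel_right1)
    then show "norm ((coord_map k h x - coord_map k h y) $ i) \<le> norm ((of_int L *\<^sub>R (x - y)) $ i)"
      using mn * assms(3) by (cases "i = k") (simp_all add: coord_map_def abs_mult)
  qed
  then show ?thesis using assms(3) by simp
qed

text \<open>The same coordinatewise comparison, now giving the lower bound needed for the inverse at
  the base point \<open>0\<close>.\<close>

lemma coord_map_co_lipschitz_at_0: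
  fixes x :: "real ^ 'n::finite" and L :: int
  assumes "x \<in> int_lattice" "L \<ge> 1" "h 0 = 0" "\<And>m. \<bar>m\<bar> \<le> L * \<bar>h m\<bar>"
  shows "norm x \<le> of_int L * norm (coord_map k h x)"
proof -
  have "norm x \<le> norm (of_int L *\<^sub>R coord_map k h x)"
  proof (rule norm_le_componentwise_cart)
    fix i
    obtain m where m: "x $ i = of_int m"
      using assms(1) unfolding int_lattice_def by (blast elim: Ints_cases)
    have *: "\<bar>real_of_int m\<bar> \<le> of_int L * \<bar>of_int (h m)\<bar>"
      using assms(4)[of m] by (metis of_int_abs of_int_le_iff of_int_mult)
    have "\<bar>real_of_int m\<bar> \<le> of_int L * \<bar>of_int m\<bar>"
      using assms(2) by (simp add: mult_le_cancel_right1)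
    then show "norm (x $ i) \<le> norm ((of_int L *\<^sub>R coord_map k h x) $ i)"
      using m * assms(2) by (cases "i = k") (simp_all add: coord_map_def abs_mult)
  qed
  then show ?thesis using assms(2) by simp
qed

lemma lipschitz_coord_map:
  assumes "strict_mono a"
  shows "lipschitz (int_lattice :: (real ^ 'n::finite) set) (coord_map k (blockwise_zigzag a))"
proof -
  have "3-lipschitz_on (int_lattice :: (real ^ 'n) set) (coord_map k (blockwise_zigzag a))"
    using coord_map_lipschitz[where L = 3 and h = "blockwise_zigzag a"]
      blockwise_zigzag_lipschitz[OF assms]
    by (intro lipschitz_onI) (auto simp: dist_norm)
  then show ?thesis unfolding lipschitz_def by blast
qed

lemma axis_in_int_lattice: "axis k (of_int m) \<in> int_lattice"
  by (simp add: axis_def int_lattice_def)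

lemma coord_map_axis: "coord_map k h (axis k (of_int m)) = axis k (of_int (h m))"
  by (simp add: axis_def coord_map_def vec_eq_iff)

lemma norm_axis: "norm (axis k u) = \<bar>u\<bar>" for u :: real
  by (simp add: norm_eq_sqrt_inner inner_axis_axis)

lemma dist_axis: "dist (axis k u) (axis k v) = \<bar>u - v\<bar>" for u v :: real
proof -
  have "axis k u - axis k v = axis k (u - v)" by (simp add: axis_def vec_eq_iff)
  then show ?thesis by (simp add: dist_norm norm_axis)
qed

text \<open>A Lipschitz constant of the inverse would have to be at least the gap of
  \<open>a\<close> on every block, by the start and the third pass.\<close>

lemma not_bi_lipschitz_coord_map:
  assumes "strict_mono a" "\<And>C. \<exists>j. a (Suc j) - a j > C"
  shows "\<not> bi_lipschitz (int_lattice :: (real ^ 'n::finite) set) int_lattice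
    (coord_map k (blockwise_zigzag a))"
proof
  let ?h = "blockwise_zigzag a"
  assume "bi_lipschitz (int_lattice :: (real ^ 'n) set) int_lattice (coord_map k ?h)"
  then obtain L where L: "\<And>x z. x \<in> (int_lattice :: (real ^ 'n) set) \<Longrightarrow> z \<in> int_lattice \<Longrightarrow>
      dist x z \<le> L * dist (coord_map k ?h x) (coord_map k ?h z)"
    using lipschitz_inv_into_iff[OF bij_betw_coord_map[OF bij_blockwise_zigzag[OF assms(1)]]]
    unfolding bi_lipschitz_def by blast
  obtain j where j: "a (Suc j) - a j > \<lceil>L\<rceil>" using assms(2) by blast
  define n where "n = a (Suc j) - a j"
  have "n > 0" using strict_monoD[OF assms(1), of j "Suc j"] by (simp add: n_def)
  have "dist (axis k (of_int (3 * a j + 2 * n)) :: real ^ 'n) (axis k (of_int (3 * a j)))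
      \<le> L * dist (axis k (of_int (?h (3 * a j + 2 * n))) :: real ^ 'n)
               (axis k (of_int (?h (3 * a j))))"
    using L[OF axis_in_int_lattice[of k] axis_in_int_lattice[of k]] unfolding coord_map_axis .
  then have "2 * real_of_int n \<le> L * 2"
    using blockwise_zigzag_third_pass[OF assms(1), of j] blockwise_zigzag_start[OF assms(1), of j]
      \<open>n > 0\<close> by (simp add: dist_axis n_def[symmetric])
  moreover have "L < of_int n"
    using j le_of_int_ceiling[of L] unfolding n_def by (meson le_less_trans of_int_less_iff)
  ultimately show False by linarith
qed

section \<open>The two examples\<close>

lemma ex_pointwise_co_lipschitz_not_bi_lipschitz:
  "\<exists>(X :: (real ^ 'd::finite) set) (Y :: (real ^ 'd) set) (f :: real ^ 'd \<Rightarrow> real ^ 'd).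
      delone X \<and> delone Y \<and> bij_betw f X Y \<and>
      lipschitz X f \<and> pointwise_co_lipschitz X Y f \<and> \<not> bi_lipschitz X Y f"
proof -
  define a :: "nat \<Rightarrow> int" where "a j = 2 ^ j" for j
  let ?h = "blockwise_zigzag a"
  have mono: "strict_mono a" by (auto simp: a_def strict_mono_Suc_iff)
  have bij: "bij_betw (coord_map k ?h) int_lattice int_lattice" for k :: 'd
    by (rule bij_betw_coord_map[OF bij_blockwise_zigzag[OF mono]])
  have h0: "?h 0 = 0" using blockwise_zigzag_below[OF mono, of 0] by (simp add: a_def)
  \<comment> \<open>Block ends double and blocks are invariant, so \<open>m\<close> and its image
    lie within a factor \<open>2\<close> of each other.\<close>
  have h: "\<bar>m\<bar> \<le> 2 * \<bar>?h m\<bar>" for m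
  proof (cases rule: block_cases[OF mono, of m])
    case 1
    then show ?thesis using blockwise_zigzag_below[OF mono] by simp
  next
    case (2 j)
    have "a (Suc j) = 2 * a j" "a j > 0" by (auto simp: a_def)
    then show ?thesis using 2 blockwise_zigzag_mem_block[OF mono 2] by linarith
  qed
  fix k :: 'd
  let ?f = "coord_map k ?h"
  have "norm x \<le> 2 * norm (?f x)" if "x \<in> int_lattice" for x :: "real ^ 'd"
    using coord_map_co_lipschitz_at_0[of x 2 ?h k] that h0 h by simp
  moreover have zero: "(0 :: real ^ 'd) \<in> int_lattice" "?f 0 = 0"
    using h0 by (auto simp: int_lattice_def coord_map_def vec_eq_iff)
  ultimately have "lipschitz_at int_lattice (inv_into int_lattice ?f) 0"
    using lipschitz_at_inv_into_iff[OF bij zero(1), of k] by (auto intro!: exI[of _ 2])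
  then have "pointwise_co_lipschitz int_lattice int_lattice ?f"
    unfolding pointwise_co_lipschitz_def
    by (rule pointwise_lipschitz_if_lipschitz_at[OF delone_int_lattice zero(1)])
  moreover have "\<exists>j. a (Suc j) - a j > C" for C
  proof -
    have "int (nat C) < 2 ^ nat C" by (rule of_nat_less_two_power)
    then have "C < 2 ^ nat C" by linarith
    then show ?thesis by (intro exI[of _ "nat C"]) (simp add: a_def)
  qed
  ultimately show ?thesis
    using delone_int_lattice bij lipschitz_coord_map[OF mono] not_bi_lipschitz_coord_map[OF mono]
    by metis
qed

lemma ex_lipschitz_not_pointwise_co_lipschitz:
  "\<exists>(X :: (real ^ 'd::finite) set) (Y :: (real ^ 'd) set) (f :: real ^ 'd \<Rightarrow> real ^ 'd).
      delone X \<and> delone Y \<and> bij_betw f X Y \<and>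
      lipschitz X f \<and> \<not> pointwise_co_lipschitz X Y f"
proof -
  \<comment> \<open>The shift by \<open>Suc\<close> avoids \<open>fact 0 = fact 1\<close>, which
    would break strict monotonicity. The ratio of gap to left end is \<open>j + 1\<close>, hence
    unbounded.\<close>
  define a :: "nat \<Rightarrow> int" where "a j = fact (Suc j)" for j
  let ?h = "blockwise_zigzag a"
  have gap: "a (Suc j) - a j = int (Suc j) * a j" for j
    by (simp add: a_def algebra_simps)
  have pos: "a j \<ge> 1" for j unfolding a_def by (rule fact_ge_1)
  have mono: "strict_mono a"
    unfolding strict_mono_Suc_iff
  proof
    fix j
    have "0 < int (Suc j) * a j" using pos[of j] by (intro mult_pos_pos) auto
    then show "a j < a (Suc j)" using gap[of j] by linarith
  qed
  have bij: "bij_betw (coord_map k ?h) int_lattice int_lattice" for k :: 'd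
    by (rule bij_betw_coord_map[OF bij_blockwise_zigzag[OF mono]])
  have h0: "?h 0 = 0" using blockwise_zigzag_below[OF mono, of 0] pos[of 0] by simp
  fix k :: 'd
  let ?f = "coord_map k ?h"
  have zero: "(0 :: real ^ 'd) \<in> int_lattice" "?f 0 = 0"
    using h0 by (auto simp: int_lattice_def coord_map_def vec_eq_iff)
  have "\<not> pointwise_co_lipschitz int_lattice int_lattice ?f"
  proof
    assume "pointwise_co_lipschitz int_lattice int_lattice ?f"
    then have "lipschitz_at int_lattice (inv_into int_lattice ?f) (?f 0)"
      using zero unfolding pointwise_co_lipschitz_def pointwise_lipschitz_def by simp
    then obtain L where L: "L > 0" "\<And>z. z \<in> int_lattice \<Longrightarrow> norm z \<le> L * norm (?f z)"
      using lipschitz_at_inv_into_iff[OF bij zero(1), of k] zero(2) by auto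
    \<comment> \<open>The image of \<open>m\<close> is \<open>3 * a j + 2\<close>, at most
      \<open>5 * a j\<close>, while \<open>m\<close> equals \<open>(5 + 2 * j) * a j\<close>. So
      \<open>5 + 2 * j \<le> 5 * L\<close> would follow, contradicting
      \<open>5 * L \<le> j\<close>.\<close>
    define j where "j = nat \<lceil>5 * L\<rceil>"
    define m where "m = 3 * a j + 2 * (a (Suc j) - a j)"
    have "norm (axis k (of_int m) :: real ^ 'd) \<le> L * norm (axis k (of_int (?h m)) :: real ^ 'd)"
      using L(2)[OF axis_in_int_lattice[of k m]] unfolding coord_map_axis .
    then have "\<bar>real_of_int m\<bar> \<le> L * \<bar>of_int (3 * a j + 2)\<bar>"
      unfolding m_def blockwise_zigzag_third_pass[OF mono] by (simp add: norm_axis)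
    also have "\<dots> \<le> L * (5 * of_int (a j))"
      using L(1) pos[of j] by (intro mult_left_mono) auto
    finally have "real_of_int m \<le> (5 * L) * of_int (a j)" by simp
    moreover have "real_of_int m = (3 + 2 * (real j + 1)) * of_int (a j)"
      unfolding m_def gap by (simp add: algebra_simps)
    ultimately have "3 + 2 * (real j + 1) \<le> 5 * L"
      using pos[of j] by simp
    moreover have "5 * L \<le> real j" unfolding j_def by linarith
    ultimately have "5 + real j \<le> 0" by argo
    then show False by simp
  qed
  then show ?thesis
    using delone_int_lattice bij lipschitz_coord_map[OF mono] by metis
qed

section \<open>Relations between the classes of maps\<close>

theorem theorem1p9:
  "(\<forall>(X :: (real ^ 'd::finite) set) (Y :: (real ^ 'd) set) (f :: real ^ 'd \<Rightarrow> real ^ 'd).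
      delone X \<and> delone Y \<and> bij_betw f X Y \<longrightarrow>
        \<comment> \<open>(1)\<close>
        (bi_lipschitz X Y f \<longleftrightarrow> lipschitz X f \<and> co_uniformly_continuous X f) \<and>
        \<comment> \<open>(2)\<close>
        ((lipschitz X f \<and> pointwise_co_lipschitz X Y f) \<longleftrightarrow>
         (lipschitz X f \<and> co_homogeneous X Y f)) \<and>
        ((lipschitz X f \<and> co_homogeneous X Y f) \<longleftrightarrow>
         (lipschitz X f \<and> (\<exists>y\<in>Y. co_lipschitz_at X Y f y))) \<and>
        \<comment> \<open>(3)\<close>
        (bi_lipschitz X Y f \<longrightarrow> lipschitz X f \<and> pointwise_co_lipschitz X Y f) \<and>
        (lipschitz X f \<and> pointwise_co_lipschitz X Y f \<longrightarrow> lipschitz X f)) \<and>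
   \<comment> \<open>(4)\<close>
   (\<exists>(X :: (real ^ 'd) set) (Y :: (real ^ 'd) set) (f :: real ^ 'd \<Rightarrow> real ^ 'd).
      delone X \<and> delone Y \<and> bij_betw f X Y \<and>
      lipschitz X f \<and> pointwise_co_lipschitz X Y f \<and> \<not> bi_lipschitz X Y f) \<and>
   (\<exists>(X :: (real ^ 'd) set) (Y :: (real ^ 'd) set) (f :: real ^ 'd \<Rightarrow> real ^ 'd).
      delone X \<and> delone Y \<and> bij_betw f X Y \<and>
      lipschitz X f \<and> \<not> pointwise_co_lipschitz X Y f)"
proof (intro conjI allI impI)
  fix X Y :: "(real ^ 'd) set" and f :: "real ^ 'd \<Rightarrow> real ^ 'd"
  assume "delone X \<and> delone Y \<and> bij_betw f X Y"
  then have Y: "delone Y" and bij: "bij_betw f X Y" by auto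
  \<comment> \<open>A point of \<open>Y\<close> is needed to pass from a condition at every point to
    one at some point.\<close>
  obtain y where y: "y \<in> Y" using delone_relatively_dense[OF Y] by blast
  show "bi_lipschitz X Y f \<longleftrightarrow> lipschitz X f \<and> co_uniformly_continuous X f"
    using bi_lipschitz_imp_co_uniformly_continuous[OF bij]
      co_uniformly_continuous_imp_lipschitz_inv[OF Y bij]
    unfolding bi_lipschitz_def by blast
  \<comment> \<open>For (2), the pointwise and the homogeneous condition are each reduced to the
    condition at a single point.\<close>
  have pw: "pointwise_co_lipschitz X Y f \<longleftrightarrow> (\<exists>y\<in>Y. co_lipschitz_at X Y f y)"
    using pointwise_lipschitz_if_lipschitz_at[OF Y] y
    unfolding pointwise_co_lipschitz_def co_lipschitz_at_def pointwise_lipschitz_def by blast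
  have hom: "co_homogeneous X Y f \<longleftrightarrow> (\<exists>y\<in>Y. co_lipschitz_at X Y f y)"
    using homogeneous_imp_lipschitz_at[OF Y y] lipschitz_at_imp_homogeneous[OF Y] y
    unfolding co_homogeneous_def co_lipschitz_at_def by blast
  show "(lipschitz X f \<and> pointwise_co_lipschitz X Y f) \<longleftrightarrow> (lipschitz X f \<and> co_homogeneous X Y f)"
    using pw hom by blast
  show "(lipschitz X f \<and> co_homogeneous X Y f) \<longleftrightarrow>
      (lipschitz X f \<and> (\<exists>y\<in>Y. co_lipschitz_at X Y f y))"
    using hom by blast
  show "lipschitz X f" if "bi_lipschitz X Y f" using that unfolding bi_lipschitz_def by blast
  show "pointwise_co_lipschitz X Y f" if "bi_lipschitz X Y f"
    using that lipschitz_imp_pointwise_lipschitz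
    unfolding bi_lipschitz_def pointwise_co_lipschitz_def by blast
  show "lipschitz X f" if "lipschitz X f \<and> pointwise_co_lipschitz X Y f" using that by blast
qed (fact ex_pointwise_co_lipschitz_not_bi_lipschitz ex_lipschitz_not_pointwise_co_lipschitz)+

end
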